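(* Let $\mathcal{V}$ be a unital commutative quantale, let $F\colon\mathsf{Set}\to\mathsf{Set}$ be a functor, let $\widehat{F}$ be a lifting of $F$ to $\mathcal{V}\text{-}\mathsf{Pred}$, and let $\overline{F}$ be the corresponding Wasserstein lifting of $F$ to $\mathcal{V}\text{-}\mathsf{Rel}$, i.e. for a $\mathcal{V}$-valued relation $p\colon X\times X\to\mathcal{V}$ and $t_1,t_2\in FX$, \[ \overline{F}(p)(t_1,t_2)=\bigvee\{\widehat{F}(p)(t)\mid t\in F(X\times X),\ F\pi_i(t)=t_i\ (i=1,2)\}, \] where $p$ is regarded as a $\mathcal{V}$-valued predicate on $X\times X$. Then: \begin{itemize} \item If $\widehat{F}(1_X)\ge 1_{FX}$, then $\overline{F}(\Delta_X)\ge\Delta_{FX}$; hence $\overline{F}$ preserves reflexive relations. \item If $\widehat{F}$ is a fibred lifting, $F$ preserves weak pullbacks, and $\widehat{F}(p\otimes q)\ge\widehat{F}(p)\otimes\widehat{F}(q)$ for all $\mathcal{V}$-valued predicates $p,q$ on the same set, then $\overline{F}(p\cdot q)\ge\overline{F}(p)\cdot\overline{F}(q)$ for all $\mathcal{V}$-valued relations $p,q$ on the same set; hence $\overline{F}$ preserves transitive relations. \item $\overline{F}$ preserves symmetric relations. \end{itemize} Consequently, when $\widehat{F}(1_X)\ge 1_{FX}$, $\widehat{F}$ is a fibred lifting, $F$ preserves weak pullbacks and $\widehat{F}(p\otimes q)\ge\widehat{F}(p)\otimes\widehat{F}(q)$, the Wasserstein lifting $\overline{F}$ restricts to a lifting of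 $F$ to both $\mathcal{V}\text{-}\mathsf{Cat}$ and $\mathcal{V}\text{-}\mathsf{Cat}_{\mathsf{sym}}$.
   Context: $\mathcal{V}$ is a unital commutative quantale with unit $1$ and tensor $\otimes$. $\mathcal{V}\text{-}\mathsf{Pred}$ is the category whose objects are maps $p\colon X\to\mathcal{V}$ and whose morphisms $p\to q$ (with $q\colon Y\to\mathcal{V}$) are maps $f\colon X\to Y$ with $p\le q\circ f$ pointwise; $\mathcal{V}\text{-}\mathsf{Rel}$ is defined likewise with objects $r\colon X\times X\to\mathcal{V}$ and condition $r\le q\circ(f\times f)$. Both are fibrations over $\mathsf{Set}$ (forgetful functor), with reindexing given by precomposition. A lifting $\widehat{F}$ of $F$ satisfies $p'\widehat{F}=Fp$ for the forgetful functors; it is fibred if the canonical morphism $\widehat{F}(f^*R)\to (Ff)^*(\widehat{F}R)$ is an isomorphism. $1_X\colon X\to\mathcal{V}$ is the constant predicate $x\mapsto 1$; $(u\otimes v)(x)=u(x)\otimes v(x)$. The diagonal relation $\Delta_X$ has $\Delta_X(x,y)=1$ if $x=y$ and $\bot$ otherwise. The composition of relations is $(p\cdot q)(x,y)=\bigvee_{z}p(x,z)\otimes q(z,y)$. A relation $r$ is reflexive if $r\ge\Delta_X$, transitive if $r\cdot r\le r$, symmetric if $r=r\circ\mathrm{sym}_X$ where $\mathrm{sym}_X$ swaps components. $\mathcal{V}\text{-}\mathsf{Cat}$ is the full subcategory of $\mathcal{V}\text{-}\mathsf{Rel}$ of reflexive transitive relations, and $\mathcal{V}\text{-}\mathsf{Cat}_{\mathsf{sym}}$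 those that are additionally symmetric. *)

theory Defs
  imports Main "HOL-Library.FuncSet"
begin

section \<open>Categories and functors\<close>

record ('o, 'a) category =
  Ob :: "'o set"
  Hom :: "'o \<Rightarrow> 'o \<Rightarrow> 'a set"
  Ident :: "'o \<Rightarrow> 'a"
  Comp :: "'o \<Rightarrow> 'o \<Rightarrow> 'o \<Rightarrow> 'a \<Rightarrow> 'a \<Rightarrow> 'a"

text \<open>
  Arrows do not carry their source and target, so these are passed explicitly:
  \<open>Comp C A B Z g f\<close> is the composite of \<open>f : A \<rightarrow> B\<close> and \<open>g : B \<rightarrow> Z\<close>, and
  \<open>Fa F A B f\<close> is the image of \<open>f : A \<rightarrow> B\<close>.
\<close>

record ('o, 'a, 'p, 'b) functor_data =
  Fo :: "'o \<Rightarrow> 'p"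
  Fa :: "'o \<Rightarrow> 'o \<Rightarrow> 'a \<Rightarrow> 'b"

definition is_functor ::
  "('o, 'a) category \<Rightarrow> ('p, 'b) category \<Rightarrow> ('o, 'a, 'p, 'b) functor_data \<Rightarrow> bool" where
  "is_functor C D F \<longleftrightarrow>
     (\<forall>A\<in>Ob C. Fo F A \<in> Ob D) \<and>
     (\<forall>A\<in>Ob C. \<forall>B\<in>Ob C. \<forall>f\<in>Hom C A B. Fa F A B f \<in> Hom D (Fo F A) (Fo F B)) \<and>
     (\<forall>A\<in>Ob C. Fa F A A (Ident C A) = Ident D (Fo F A)) \<and>
     (\<forall>A\<in>Ob C. \<forall>B\<in>Ob C. \<forall>Z\<in>Ob C. \<forall>f\<in>Hom C A B. \<forall>g\<in>Hom C B Z.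
        Fa F A Z (Comp C A B Z g f)
          = Comp D (Fo F A) (Fo F B) (Fo F Z) (Fa F B Z g) (Fa F A B f))"

definition is_iso :: "('o, 'a) category \<Rightarrow> 'o \<Rightarrow> 'o \<Rightarrow> 'a \<Rightarrow> bool" where
  "is_iso C A B f \<longleftrightarrow> f \<in> Hom C A B \<and>
     (\<exists>g\<in>Hom C B A. Comp C A B A g f = Ident C A \<and> Comp C B A B f g = Ident C B)"

definition weak_pullback ::
  "('o, 'a) category \<Rightarrow> 'o \<Rightarrow> 'o \<Rightarrow> 'o \<Rightarrow> 'o \<Rightarrow> 'a \<Rightarrow> 'a \<Rightarrow> 'a \<Rightarrow> 'a \<Rightarrow> bool" where
  "weak_pullback C P A B Z p q f g \<longleftrightarrow>
     P \<in> Ob C \<and> A \<in> Ob C \<and> B \<in> Ob C \<and> Z \<in> Ob C \<and>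
     p \<in> Hom C P A \<and> q \<in> Hom C P B \<and> f \<in> Hom C A Z \<and> g \<in> Hom C B Z \<and>
     Comp C P A Z f p = Comp C P B Z g q \<and>
     (\<forall>T\<in>Ob C. \<forall>h\<in>Hom C T A. \<forall>k\<in>Hom C T B. Comp C T A Z f h = Comp C T B Z g k \<longrightarrow>
        (\<exists>u\<in>Hom C T P. Comp C T P A p u = h \<and> Comp C T P B q u = k))"

definition preserves_weak_pullbacks ::
  "('o, 'a) category \<Rightarrow> ('p, 'b) category \<Rightarrow> ('o, 'a, 'p, 'b) functor_data \<Rightarrow> bool" where
  "preserves_weak_pullbacks C D F \<longleftrightarrow>
     (\<forall>P A B Z p q f g. weak_pullback C P A B Z p q f g \<longrightarrow>
        weak_pullback D (Fo F P) (Fo F A) (Fo F B) (Fo F Z)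
          (Fa F P A p) (Fa F P B q) (Fa F A Z f) (Fa F B Z g))"

definition full_subcategory :: "('o, 'a) category \<Rightarrow> ('o \<Rightarrow> bool) \<Rightarrow> ('o, 'a) category" where
  "full_subcategory C Q = C\<lparr>Ob := {A \<in> Ob C. Q A}\<rparr>"

text \<open>The equality \<open>P \<circ> G = F \<circ> P\<close> of functors from \<open>C\<close>, on objects and on arrows.\<close>

definition is_lifting ::
  "('o, 'a) category \<Rightarrow> ('o, 'a, 'p, 'b) functor_data \<Rightarrow> ('p, 'b, 'p, 'b) functor_data
     \<Rightarrow> ('o, 'a, 'o, 'a) functor_data \<Rightarrow> bool" where
  "is_lifting C P F G \<longleftrightarrow> is_functor C C G \<and>
     (\<forall>A\<in>Ob C. Fo P (Fo G A) = Fo F (Fo P A)) \<and>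
     (\<forall>A\<in>Ob C. \<forall>B\<in>Ob C. \<forall>f\<in>Hom C A B.
        Fa P (Fo G A) (Fo G B) (Fa G A B f) = Fa F (Fo P A) (Fo P B) (Fa P A B f))"


section \<open>The category of sets\<close>

text \<open>
  HOL has no type of all sets, so the category of sets is formed from a collection \<open>U\<close> of
  sets over a type \<open>'u\<close>, with a pairing function by which binary products are again sets
  over \<open>'u\<close>. Only these closure properties are imposed on \<open>U\<close>. The small sets over
  a type modelling ZFC (with Kuratowski pairs), the sets in a Grothendieck universe, and all
  subsets of any infinite type (with a suitable pairing) are instances.
\<close>

locale set_universe =
  fixes U :: "'u set set"
    and pair :: "'u \<Rightarrow> 'u \<Rightarrow> 'u"
  assumes pair_inject: "pair a b = pair c d \<Longrightarrow> a = c \<and> b = d"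
    and prod_closed: "X \<in> U \<Longrightarrow> Y \<in> U \<Longrightarrow> {pair x y | x y. x \<in> X \<and> y \<in> Y} \<in> U"
    and subset_closed: "X \<in> U \<Longrightarrow> Y \<subseteq> X \<Longrightarrow> Y \<in> U"

definition uprod :: "('u \<Rightarrow> 'u \<Rightarrow> 'u) \<Rightarrow> 'u set \<Rightarrow> 'u set \<Rightarrow> 'u set" where
  "uprod pair X Y = {pair x y | x y. x \<in> X \<and> y \<in> Y}"

definition unpair :: "('u \<Rightarrow> 'u \<Rightarrow> 'u) \<Rightarrow> 'u \<Rightarrow> 'u \<times> 'u" where
  "unpair pair z = (THE w. z = pair (fst w) (snd w))"

definition proj1 :: "('u \<Rightarrow> 'u \<Rightarrow> 'u) \<Rightarrow> 'u set \<Rightarrow> 'u set \<Rightarrow> 'u \<Rightarrow> 'u" where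
  "proj1 pair X Y = (\<lambda>z\<in>uprod pair X Y. fst (unpair pair z))"

definition proj2 :: "('u \<Rightarrow> 'u \<Rightarrow> 'u) \<Rightarrow> 'u set \<Rightarrow> 'u set \<Rightarrow> 'u \<Rightarrow> 'u" where
  "proj2 pair X Y = (\<lambda>z\<in>uprod pair X Y. snd (unpair pair z))"

definition SetCat :: "'u set set \<Rightarrow> ('u set, 'u \<Rightarrow> 'u) category" where
  "SetCat U = \<lparr>Ob = U, Hom = (\<lambda>X Y. X \<rightarrow>\<^sub>E Y), Ident = (\<lambda>X. \<lambda>x\<in>X. x),
     Comp = (\<lambda>X Y Z g f. compose X g f)\<rparr>"


section \<open>Quantale-valued predicates and relations\<close>

class unital_comm_quantale = complete_lattice + comm_monoid_mult +
  assumes mult_Sup_distrib: "x * Sup A = Sup ((\<lambda>y. x * y) ` A)"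

definition le_on :: "'a set \<Rightarrow> ('a \<Rightarrow> 'v::order) \<Rightarrow> ('a \<Rightarrow> 'v) \<Rightarrow> bool" where
  "le_on S p q \<longleftrightarrow> (\<forall>x\<in>S. p x \<le> q x)"

type_synonym ('u, 'v) vpred = "'u set \<times> ('u \<Rightarrow> 'v)"
type_synonym ('u, 'v) vrel = "'u set \<times> ('u \<times> 'u \<Rightarrow> 'v)"

definition VPred :: "'u set set \<Rightarrow> (('u, 'v::unital_comm_quantale) vpred, 'u \<Rightarrow> 'u) category" where
  "VPred U = \<lparr>Ob = {(X, p). X \<in> U \<and> p \<in> extensional X},
     Hom = (\<lambda>(X, p) (Y, q). {f \<in> X \<rightarrow>\<^sub>E Y. le_on X p (\<lambda>x. q (f x))}),
     Ident = (\<lambda>(X, p). \<lambda>x\<in>X. x),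
     Comp = (\<lambda>(X, p) (Y, q) (Z, r) g f. compose X g f)\<rparr>"

definition VRel :: "'u set set \<Rightarrow> (('u, 'v::unital_comm_quantale) vrel, 'u \<Rightarrow> 'u) category" where
  "VRel U = \<lparr>Ob = {(X, r). X \<in> U \<and> r \<in> extensional (X \<times> X)},
     Hom = (\<lambda>(X, r) (Y, q). {f \<in> X \<rightarrow>\<^sub>E Y. le_on (X \<times> X) r (\<lambda>(x, y). q (f x, f y))}),
     Ident = (\<lambda>(X, r). \<lambda>x\<in>X. x),
     Comp = (\<lambda>(X, r) (Y, q) (Z, s) g f. compose X g f)\<rparr>"

definition forgetful :: "('u set \<times> 'p, 'u \<Rightarrow> 'u, 'u set, 'u \<Rightarrow> 'u) functor_data" where
  "forgetful = \<lparr>Fo = fst, Fa = (\<lambda>A B f. f)\<rparr>"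

definition reindex_pred :: "'u set \<Rightarrow> ('u \<Rightarrow> 'u) \<Rightarrow> ('u, 'v) vpred \<Rightarrow> ('u, 'v) vpred" where
  "reindex_pred X f R = (X, \<lambda>x\<in>X. snd R (f x))"

text \<open>
  The canonical morphism from the lifted reindexing to the reindexed lifting is the unique
  vertical one, so its underlying map is the identity on \<open>F X\<close>.
\<close>

definition fibred_lifting ::
  "'u set set \<Rightarrow> ('u set, 'u \<Rightarrow> 'u, 'u set, 'u \<Rightarrow> 'u) functor_data
     \<Rightarrow> (('u, 'v::unital_comm_quantale) vpred, 'u \<Rightarrow> 'u, ('u, 'v) vpred, 'u \<Rightarrow> 'u) functor_data
     \<Rightarrow> bool" where
  "fibred_lifting U F G \<longleftrightarrow> is_lifting (VPred U) forgetful F G \<and>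
     (\<forall>X\<in>U. \<forall>R\<in>Ob (VPred U). \<forall>f\<in>X \<rightarrow>\<^sub>E fst R.
        is_iso (VPred U)
          (Fo G (reindex_pred X f R))
          (reindex_pred (Fo F X) (Fa F X (fst R) f) (Fo G R))
          (\<lambda>t\<in>Fo F X. t))"

definition one_pred :: "'u set \<Rightarrow> 'u \<Rightarrow> 'v::unital_comm_quantale" where
  "one_pred X = (\<lambda>x\<in>X. 1)"

definition tensor_pred ::
  "'u set \<Rightarrow> ('u \<Rightarrow> 'v::unital_comm_quantale) \<Rightarrow> ('u \<Rightarrow> 'v) \<Rightarrow> 'u \<Rightarrow> 'v" where
  "tensor_pred X p q = (\<lambda>x\<in>X. p x * q x)"

definition diag_rel :: "'u set \<Rightarrow> 'u \<times> 'u \<Rightarrow> 'v::unital_comm_quantale" where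
  "diag_rel X = (\<lambda>(x, y)\<in>X \<times> X. if x = y then 1 else bot)"

definition comp_rel ::
  "'u set \<Rightarrow> ('u \<times> 'u \<Rightarrow> 'v::unital_comm_quantale) \<Rightarrow> ('u \<times> 'u \<Rightarrow> 'v) \<Rightarrow> 'u \<times> 'u \<Rightarrow> 'v" where
  "comp_rel X p q = (\<lambda>(x, y)\<in>X \<times> X. SUP z\<in>X. p (x, z) * q (z, y))"

definition reflexive_rel :: "('u, 'v::unital_comm_quantale) vrel \<Rightarrow> bool" where
  "reflexive_rel = (\<lambda>(X, r). le_on (X \<times> X) (diag_rel X) r)"

definition transitive_rel :: "('u, 'v::unital_comm_quantale) vrel \<Rightarrow> bool" where
  "transitive_rel = (\<lambda>(X, r). le_on (X \<times> X) (comp_rel X r r) r)"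

definition symmetric_rel :: "('u, 'v::unital_comm_quantale) vrel \<Rightarrow> bool" where
  "symmetric_rel = (\<lambda>(X, r). r = (\<lambda>(x, y)\<in>X \<times> X. r (y, x)))"

definition VCat :: "'u set set \<Rightarrow> (('u, 'v::unital_comm_quantale) vrel, 'u \<Rightarrow> 'u) category" where
  "VCat U = full_subcategory (VRel U) (\<lambda>R. reflexive_rel R \<and> transitive_rel R)"

definition VCat_sym :: "'u set set \<Rightarrow> (('u, 'v::unital_comm_quantale) vrel, 'u \<Rightarrow> 'u) category" where
  "VCat_sym U =
     full_subcategory (VRel U) (\<lambda>R. reflexive_rel R \<and> transitive_rel R \<and> symmetric_rel R)"


section \<open>The Wasserstein lifting\<close>

definition rel_as_pred ::
  "('u \<Rightarrow> 'u \<Rightarrow> 'u) \<Rightarrow> ('u, 'v) vrel \<Rightarrow> ('u, 'v) vpred" where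
  "rel_as_pred pair = (\<lambda>(X, r). (uprod pair X X, \<lambda>z\<in>uprod pair X X. r (unpair pair z)))"

definition wasserstein ::
  "('u \<Rightarrow> 'u \<Rightarrow> 'u) \<Rightarrow> ('u set, 'u \<Rightarrow> 'u, 'u set, 'u \<Rightarrow> 'u) functor_data
     \<Rightarrow> (('u, 'v::unital_comm_quantale) vpred, 'u \<Rightarrow> 'u, ('u, 'v) vpred, 'u \<Rightarrow> 'u) functor_data
     \<Rightarrow> (('u, 'v) vrel, 'u \<Rightarrow> 'u, ('u, 'v) vrel, 'u \<Rightarrow> 'u) functor_data" where
  "wasserstein pair F G =
     \<lparr>Fo = (\<lambda>(X, r). (Fo F X, \<lambda>(t1, t2)\<in>Fo F X \<times> Fo F X.
        Sup {snd (Fo G (rel_as_pred pair (X, r))) t | t.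
               t \<in> Fo F (uprod pair X X) \<and>
               Fa F (uprod pair X X) X (proj1 pair X X) t = t1 \<and>
               Fa F (uprod pair X X) X (proj2 pair X X) t = t2})),
      Fa = (\<lambda>A B f. Fa F (fst A) (fst B) f)\<rparr>"

end

theory Submission
  imports Defs
begin

text \<open>
  Everything rests on one inequality (\<open>lift_le_wasserstein\<close>): for maps \<open>g, h : T \<rightarrow> X\<close> and a
  predicate \<open>p\<close> on \<open>T\<close> with \<open>p z \<le> r (g z, h z)\<close>, pushing \<open>t \<in> F T\<close> forward along
  \<open>\<langle>g, h\<rangle> : T \<rightarrow> X \<times> X\<close> gives a coupling of \<open>F g t\<close> and \<open>F h t\<close>, whence the value of the
  lifting of \<open>p\<close> at \<open>t\<close> is at most the Wasserstein lifting of \<open>r\<close> at \<open>(F g t, F h t)\<close>.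
  Reflexivity is the case \<open>g = h = id\<close>, symmetry the case of the two projections exchanged, and
  functoriality the case of the two projections followed by a map. For transitivity, \<open>T\<close> is the
  pullback of the second projection along the first: a weak-pullback-preserving \<open>F\<close> glues a
  coupling of \<open>(x, z)\<close> and one of \<open>(z, y)\<close> to an element of \<open>F T\<close>, and fibredness with the
  tensor condition bounds the product of their values there.
\<close>

section \<open>Order and multiplication in a commutative quantale\<close>

text \<open>The class axiom distributes over joins in the right factor; commutativity gives the left
  one, so the two joins are removed one after the other. This later reduces a product of two
  Wasserstein suprema to a product of values at two couplings.\<close>

lemma quantale_Sup_mult_le:
  fixes A B :: "'v::unital_comm_quantale set"
  assumes "\<And>a b. a \<in> A \<Longrightarrow> b \<in> B \<Longrightarrow> a * b \<le> c"
  shows "Sup A * Sup B \<le> c"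
proof -
  have "Sup A * b \<le> c" if "b \<in> B" for b
  proof -
    have "Sup A * b = Sup ((\<lambda>a. b * a) ` A)"
      by (metis mult_Sup_distrib mult.commute)
    also have "\<dots> \<le> c"
      using assms that by (auto intro!: Sup_least simp: mult.commute)
    finally show ?thesis .
  qed
  then show ?thesis
    by (auto simp: mult_Sup_distrib intro!: Sup_least)
qed

text \<open>Monotonicity comes from distributivity over a two-element join: if
  \<open>y \<le> z\<close>, then \<open>z = Sup {y, z}\<close>, so \<open>x * z\<close> is a join
  with \<open>x * y\<close> among its members.\<close>

lemma quantale_mult_mono:
  fixes a b c d :: "'v::unital_comm_quantale"
  assumes "a \<le> c" "b \<le> d"
  shows "a * b \<le> c * d"
proof -
  have mono: "x * y \<le> x * z" if "y \<le> z" for x y z :: 'v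
  proof -
    have "x * z = x * Sup {y, z}"
      using that by (simp add: sup_absorb2)
    also have "\<dots> = Sup {x * y, x * z}"
      by (subst mult_Sup_distrib) simp
    finally show ?thesis
      by (metis Sup_upper insertI1)
  qed
  show ?thesis
    using mono[OF assms(1), of b] mono[OF assms(2), of c] by (metis mult.commute order_trans)
qed

section \<open>Encoded products and weak pullbacks of sets\<close>

context set_universe
begin

lemma unpair_pair [simp]: "unpair pair (pair x y) = (x, y)"
  unfolding unpair_def by (rule the_equality) (auto dest: pair_inject)

lemma uprod_in_U: "X \<in> U \<Longrightarrow> Y \<in> U \<Longrightarrow> uprod pair X Y \<in> U"
  unfolding uprod_def by (rule prod_closed)

lemma pair_in_uprod [simp]: "pair x y \<in> uprod pair X Y \<longleftrightarrow> x \<in> X \<and> y \<in> Y"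
  unfolding uprod_def by (blast dest: pair_inject)

lemma uprodE:
  assumes "z \<in> uprod pair X Y"
  obtains x y where "z = pair x y" "x \<in> X" "y \<in> Y"
  using assms unfolding uprod_def by blast

lemma proj1_pair [simp]: "x \<in> X \<Longrightarrow> y \<in> Y \<Longrightarrow> proj1 pair X Y (pair x y) = x"
  and proj2_pair [simp]: "x \<in> X \<Longrightarrow> y \<in> Y \<Longrightarrow> proj2 pair X Y (pair x y) = y"
  by (simp_all add: proj1_def proj2_def)

lemma proj1_in: "proj1 pair X Y \<in> uprod pair X Y \<rightarrow>\<^sub>E X"
  and proj2_in: "proj2 pair X Y \<in> uprod pair X Y \<rightarrow>\<^sub>E Y"
  by (auto simp: proj1_def proj2_def elim!: uprodE)

text \<open>This is the usual fibre product inside the encoded product. It is an object because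
  \<open>U\<close> is closed under products and subsets, and the mediating map of \<open>h\<close>
  and \<open>k\<close> is their pairing.\<close>

lemma weak_pullback_subset_uprod:
  assumes "A \<in> U" "B \<in> U" "Z \<in> U" "f \<in> A \<rightarrow>\<^sub>E Z" "g \<in> B \<rightarrow>\<^sub>E Z"
  defines "P \<equiv> {w \<in> uprod pair A B. f (proj1 pair A B w) = g (proj2 pair A B w)}"
  shows "weak_pullback (SetCat U) P A B Z
    (restrict (proj1 pair A B) P) (restrict (proj2 pair A B) P) f g"
proof -
  have P: "P \<in> U"
    using subset_closed[OF uprod_in_U[OF assms(1,2)], of P] unfolding P_def by blast
  have p: "restrict (proj1 pair A B) P \<in> P \<rightarrow>\<^sub>E A" "restrict (proj2 pair A B) P \<in> P \<rightarrow>\<^sub>E B"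
    using proj1_in[of A B] proj2_in[of A B] unfolding P_def by auto
  have comm: "compose P f (restrict (proj1 pair A B) P) = compose P g (restrict (proj2 pair A B) P)"
    by (auto simp: compose_def fun_eq_iff P_def)
  have "\<exists>u\<in>T \<rightarrow>\<^sub>E P. compose T (restrict (proj1 pair A B) P) u = h \<and>
      compose T (restrict (proj2 pair A B) P) u = k"
    if h: "h \<in> T \<rightarrow>\<^sub>E A" and k: "k \<in> T \<rightarrow>\<^sub>E B" and eq: "compose T f h = compose T g k" for T h k
  proof -
    have fg: "f (h x) = g (k x)" if "x \<in> T" for x
      using fun_cong[OF eq, of x] that by (simp add: compose_eq)
    have inP: "pair (h x) (k x) \<in> P" if "x \<in> T" for x
      using PiE_mem[OF h that] PiE_mem[OF k that] fg[OF that] by (simp add: P_def)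
    have "compose T (restrict (proj1 pair A B) P) (\<lambda>x\<in>T. pair (h x) (k x)) = h"
    proof (rule extensionalityI[of _ T])
      fix x assume x: "x \<in> T"
      show "compose T (restrict (proj1 pair A B) P) (\<lambda>x\<in>T. pair (h x) (k x)) x = h x"
        using x inP[OF x] PiE_mem[OF h x] PiE_mem[OF k x] by (simp add: compose_eq)
    qed (use h in \<open>auto simp: PiE_def\<close>)
    moreover have "compose T (restrict (proj2 pair A B) P) (\<lambda>x\<in>T. pair (h x) (k x)) = k"
    proof (rule extensionalityI[of _ T])
      fix x assume x: "x \<in> T"
      show "compose T (restrict (proj2 pair A B) P) (\<lambda>x\<in>T. pair (h x) (k x)) x = k x"
        using x inP[OF x] PiE_mem[OF h x] PiE_mem[OF k x] by (simp add: compose_eq)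
    qed (use k in \<open>auto simp: PiE_def\<close>)
    moreover have "(\<lambda>x\<in>T. pair (h x) (k x)) \<in> T \<rightarrow>\<^sub>E P"
      using inP by auto
    ultimately show ?thesis
      by blast
  qed
  then show ?thesis
    using assms(1-5) P p comm by (simp add: weak_pullback_def SetCat_def) blast
qed

text \<open>The universal property is tested on a one-point set, whose maps are elements;
  \<open>{a}\<close> serves because it is a subset of \<open>A\<close> and hence in
  \<open>U\<close>. The lemma is meant for the image of a weak pullback under \<open>F\<close>,
  which has no description by pairs.\<close>

lemma weak_pullback_element:
  assumes wp: "weak_pullback (SetCat U) P A B Z p q f g"
    and a: "a \<in> A" and b: "b \<in> B" and eq: "f a = g b"
  obtains w where "w \<in> P" "p w = a" "q w = b"
proof -
  have "A \<in> U"
    using wp by (simp add: weak_pullback_def SetCat_def)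
  then have T: "{a} \<in> U"
    using subset_closed[of A "{a}"] a by simp
  have "compose {a} f (\<lambda>_\<in>{a}. a) = compose {a} g (\<lambda>_\<in>{a}. b)"
    using eq by (auto simp: compose_def)
  moreover have "(\<lambda>_\<in>{a}. a) \<in> {a} \<rightarrow>\<^sub>E A" "(\<lambda>_\<in>{a}. b) \<in> {a} \<rightarrow>\<^sub>E B"
    using a b by auto
  moreover have "\<forall>T\<in>U. \<forall>h\<in>T \<rightarrow>\<^sub>E A. \<forall>k\<in>T \<rightarrow>\<^sub>E B. compose T f h = compose T g k \<longrightarrow>
      (\<exists>u\<in>T \<rightarrow>\<^sub>E P. compose T p u = h \<and> compose T q u = k)"
    using wp by (simp add: weak_pullback_def SetCat_def)
  ultimately obtain u where u: "u \<in> {a} \<rightarrow>\<^sub>E P"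
    and ua: "compose {a} p u = (\<lambda>_\<in>{a}. a)" and ub: "compose {a} q u = (\<lambda>_\<in>{a}. b)"
    using T by meson
  show thesis
  proof
    show "u a \<in> P"
      using u by auto
    show "p (u a) = a" "q (u a) = b"
      using fun_cong[OF ua, of a] fun_cong[OF ub, of a] by (simp_all add: compose_eq)
  qed
qed

end

section \<open>The functor and its predicate lifting in elementary terms\<close>

locale set_functor_lifting = set_universe U pair
  for U :: "'u set set" and pair :: "'u \<Rightarrow> 'u \<Rightarrow> 'u" +
  fixes F :: "('u set, 'u \<Rightarrow> 'u, 'u set, 'u \<Rightarrow> 'u) functor_data"
    and Fhat :: "(('u, 'v::unital_comm_quantale) vpred, 'u \<Rightarrow> 'u, ('u, 'v) vpred, 'u \<Rightarrow> 'u) functor_data"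
  assumes is_functor: "is_functor (SetCat U) (SetCat U) F"
    and is_lifting: "is_lifting (VPred U) forgetful F Fhat"
begin

abbreviation lift_pred :: "'u set \<Rightarrow> ('u \<Rightarrow> 'v) \<Rightarrow> 'u \<Rightarrow> 'v" where
  "lift_pred X p \<equiv> snd (Fo Fhat (X, p))"

abbreviation lift_rel :: "'u set \<Rightarrow> ('u \<times> 'u \<Rightarrow> 'v) \<Rightarrow> 'u \<times> 'u \<Rightarrow> 'v" where
  "lift_rel X r \<equiv> snd (Fo (wasserstein pair F Fhat) (X, r))"

abbreviation preserves_one :: bool where
  "preserves_one \<equiv> \<forall>X\<in>U. le_on (Fo F X) (one_pred (Fo F X)) (lift_pred X (one_pred X))"

abbreviation preserves_tensor :: bool where
  "preserves_tensor \<equiv> \<forall>X\<in>U. \<forall>p\<in>extensional X. \<forall>q\<in>extensional X.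
     le_on (Fo F X) (tensor_pred (Fo F X) (lift_pred X p) (lift_pred X q))
       (lift_pred X (tensor_pred X p q))"

lemma F_obj: "X \<in> U \<Longrightarrow> Fo F X \<in> U"
  using is_functor by (simp add: is_functor_def SetCat_def)

lemma F_map: "X \<in> U \<Longrightarrow> Y \<in> U \<Longrightarrow> f \<in> X \<rightarrow>\<^sub>E Y \<Longrightarrow> Fa F X Y f \<in> Fo F X \<rightarrow>\<^sub>E Fo F Y"
  using is_functor by (simp add: is_functor_def SetCat_def)

lemma F_id: "X \<in> U \<Longrightarrow> Fa F X X (\<lambda>x\<in>X. x) = (\<lambda>t\<in>Fo F X. t)"
  using is_functor by (simp add: is_functor_def SetCat_def)

lemma F_compose:
  "X \<in> U \<Longrightarrow> Y \<in> U \<Longrightarrow> Z \<in> U \<Longrightarrow> f \<in> X \<rightarrow>\<^sub>E Y \<Longrightarrow> g \<in> Y \<rightarrow>\<^sub>E Z \<Longrightarrow>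
    Fa F X Z (compose X g f) = compose (Fo F X) (Fa F Y Z g) (Fa F X Y f)"
  using is_functor by (simp add: is_functor_def SetCat_def)

lemma F_compose_apply:
  "X \<in> U \<Longrightarrow> Y \<in> U \<Longrightarrow> Z \<in> U \<Longrightarrow> f \<in> X \<rightarrow>\<^sub>E Y \<Longrightarrow> g \<in> Y \<rightarrow>\<^sub>E Z \<Longrightarrow> t \<in> Fo F X \<Longrightarrow>
    Fa F X Z (compose X g f) t = Fa F Y Z g (Fa F X Y f t)"
  by (simp add: F_compose compose_eq)

lemma fst_Fhat:
  assumes "X \<in> U" "p \<in> extensional X"
  shows "fst (Fo Fhat (X, p)) = Fo F X"
  using is_lifting assms by (auto simp: is_lifting_def VPred_def forgetful_def)

text \<open>The assumption on \<open>f\<close> makes it a morphism of predicates. A lifting sends it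
  to a morphism with underlying map \<open>Fa F X Y f\<close>, and the inequality is the condition
  on that morphism.\<close>

lemma lift_pred_mono:
  assumes X: "X \<in> U" "p \<in> extensional X" and Y: "Y \<in> U" "q \<in> extensional Y"
    and f: "f \<in> X \<rightarrow>\<^sub>E Y" "\<And>x. x \<in> X \<Longrightarrow> p x \<le> q (f x)" and t: "t \<in> Fo F X"
  shows "lift_pred X p t \<le> lift_pred Y q (Fa F X Y f t)"
proof -
  have A: "(X, p) \<in> Ob (VPred U)" and B: "(Y, q) \<in> Ob (VPred U)"
    using X Y by (auto simp: VPred_def)
  have fh: "f \<in> Hom (VPred U) (X, p) (Y, q)"
    using f by (auto simp: VPred_def le_on_def)
  have "Fa Fhat (X, p) (Y, q) f \<in> Hom (VPred U) (Fo Fhat (X, p)) (Fo Fhat (Y, q))"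
    using is_lifting A B fh unfolding is_lifting_def is_functor_def by blast
  moreover have "Fa Fhat (X, p) (Y, q) f = Fa F X Y f"
    using is_lifting A B fh unfolding is_lifting_def forgetful_def by fastforce
  ultimately have "le_on (fst (Fo Fhat (X, p))) (lift_pred X p) (\<lambda>t. lift_pred Y q (Fa F X Y f t))"
    by (simp add: VPred_def case_prod_beta)
  then show ?thesis
    using t by (simp add: le_on_def fst_Fhat[OF X])
qed

text \<open>Fibredness supplies the inequality opposite to the one that
  \<open>lift_pred_mono\<close> gives for reindexed predicates: it is the morphism condition of the
  inverse of the canonical isomorphism.\<close>

lemma fibred_lift_reindex:
  assumes fib: "fibred_lifting U F Fhat"
    and X: "X \<in> U" and Y: "Y \<in> U" "q \<in> extensional Y" and f: "f \<in> X \<rightarrow>\<^sub>E Y" and t: "t \<in> Fo F X"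
  shows "lift_pred Y q (Fa F X Y f t) \<le> lift_pred X (\<lambda>x\<in>X. q (f x)) t"
proof -
  let ?A = "Fo Fhat (reindex_pred X f (Y, q))"
  let ?B = "reindex_pred (Fo F X) (Fa F X Y f) (Fo Fhat (Y, q))"
  have "(Y, q) \<in> Ob (VPred U)"
    using Y by (simp add: VPred_def)
  then have "is_iso (VPred U) ?A ?B (\<lambda>t\<in>Fo F X. t)"
    using fib X f unfolding fibred_lifting_def by fastforce
  then obtain g where g: "g \<in> Hom (VPred U) ?B ?A"
    and eq: "Comp (VPred U) ?B ?A ?B (\<lambda>t\<in>Fo F X. t) g = Ident (VPred U) ?B"
    unfolding is_iso_def by blast
  have A: "fst ?A = Fo F X"
    using X by (simp add: reindex_pred_def fst_Fhat)
  have B: "fst ?B = Fo F X"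
    by (simp add: reindex_pred_def)
  have gm: "g \<in> Fo F X \<rightarrow>\<^sub>E Fo F X" and gle: "le_on (Fo F X) (snd ?B) (\<lambda>x. snd ?A (g x))"
    using g A B by (simp_all add: VPred_def case_prod_beta)
  \<comment> \<open>The canonical morphism is the identity on underlying sets, so its inverse
    \<open>g\<close> must fix every element of \<open>Fo F X\<close>.\<close>
  have "compose (Fo F X) (\<lambda>t\<in>Fo F X. t) g = (\<lambda>t\<in>Fo F X. t)"
    using eq A B by (simp add: VPred_def case_prod_beta)
  from fun_cong[OF this, of t] have "g t = t"
    using t PiE_mem[OF gm t] by (simp add: compose_eq)
  with gle t have "snd ?B t \<le> snd ?A t"
    unfolding le_on_def by metis
  then show ?thesis
    using t by (simp add: reindex_pred_def)
qed

section \<open>The Wasserstein lifting as a supremum over couplings\<close>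

lemma rel_as_pred_pair:
  "rel_as_pred pair (X, r) = (uprod pair X X, \<lambda>z\<in>uprod pair X X. r (unpair pair z))"
  by (simp add: rel_as_pred_def)

lemma fst_wasserstein: "fst (Fo (wasserstein pair F Fhat) (X, r)) = Fo F X"
  by (simp add: wasserstein_def)

lemma Fa_wasserstein: "Fa (wasserstein pair F Fhat) A B f = Fa F (fst A) (fst B) f"
  by (simp add: wasserstein_def)

lemma lift_rel_extensional: "lift_rel X r \<in> extensional (Fo F X \<times> Fo F X)"
  by (simp add: wasserstein_def)

lemma lift_rel_eq:
  assumes "t1 \<in> Fo F X" "t2 \<in> Fo F X"
  shows "lift_rel X r (t1, t2) =
    Sup {lift_pred (uprod pair X X) (\<lambda>z\<in>uprod pair X X. r (unpair pair z)) t | t.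
      t \<in> Fo F (uprod pair X X) \<and>
      Fa F (uprod pair X X) X (proj1 pair X X) t = t1 \<and>
      Fa F (uprod pair X X) X (proj2 pair X X) t = t2}"
  using assms by (simp add: wasserstein_def rel_as_pred_pair)

lemma lift_le_wasserstein:
  assumes T: "T \<in> U" "p \<in> extensional T" and X: "X \<in> U"
    and g: "g \<in> T \<rightarrow>\<^sub>E X" and h: "h \<in> T \<rightarrow>\<^sub>E X"
    and le: "\<And>z. z \<in> T \<Longrightarrow> p z \<le> r (g z, h z)" and t: "t \<in> Fo F T"
  shows "lift_pred T p t \<le> lift_rel X r (Fa F T X g t, Fa F T X h t)"
proof -
  let ?XX = "uprod pair X X"
  let ?f = "\<lambda>z\<in>T. pair (g z) (h z)"
  have XX: "?XX \<in> U"
    using X by (simp add: uprod_in_U)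
  have f: "?f \<in> T \<rightarrow>\<^sub>E ?XX"
    using g h by (auto simp: PiE_mem)
  have c1: "compose T (proj1 pair X X) ?f = g"
  proof (rule extensionalityI[of _ T])
    fix x assume x: "x \<in> T"
    show "compose T (proj1 pair X X) ?f x = g x"
      using x PiE_mem[OF g x] PiE_mem[OF h x] by (simp add: compose_eq)
  qed (use g in \<open>auto simp: PiE_def\<close>)
  have c2: "compose T (proj2 pair X X) ?f = h"
  proof (rule extensionalityI[of _ T])
    fix x assume x: "x \<in> T"
    show "compose T (proj2 pair X X) ?f x = h x"
      using x PiE_mem[OF g x] PiE_mem[OF h x] by (simp add: compose_eq)
  qed (use h in \<open>auto simp: PiE_def\<close>)
  have ft: "Fa F T ?XX ?f t \<in> Fo F ?XX"
    using F_map[OF T(1) XX f] t by (rule PiE_mem)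
  \<comment> \<open>Functoriality turns \<open>c1\<close> and \<open>c2\<close> into the two
    marginals of the coupling.\<close>
  have 1: "Fa F ?XX X (proj1 pair X X) (Fa F T ?XX ?f t) = Fa F T X g t"
    using F_compose_apply[OF T(1) XX X f proj1_in t] by (simp add: c1)
  have 2: "Fa F ?XX X (proj2 pair X X) (Fa F T ?XX ?f t) = Fa F T X h t"
    using F_compose_apply[OF T(1) XX X f proj2_in t] by (simp add: c2)
  have mem: "Fa F T X g t \<in> Fo F X" "Fa F T X h t \<in> Fo F X"
    using F_map[OF T(1) X g] F_map[OF T(1) X h] t by (auto simp: PiE_mem)
  have "lift_pred T p t \<le>
      lift_pred ?XX (\<lambda>z\<in>?XX. r (unpair pair z)) (Fa F T ?XX ?f t)"
    using T XX f t le g h by (intro lift_pred_mono) (auto simp: PiE_mem)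
  also have "\<dots> \<le> lift_rel X r (Fa F T X g t, Fa F T X h t)"
    unfolding lift_rel_eq[OF mem] using ft 1 2 by (intro Sup_upper) blast
  finally show ?thesis .
qed

lemma lift_rel_le:
  assumes "t1 \<in> Fo F X" "t2 \<in> Fo F X"
    and "\<And>t. t \<in> Fo F (uprod pair X X) \<Longrightarrow>
      Fa F (uprod pair X X) X (proj1 pair X X) t = t1 \<Longrightarrow>
      Fa F (uprod pair X X) X (proj2 pair X X) t = t2 \<Longrightarrow>
      lift_pred (uprod pair X X) (\<lambda>z\<in>uprod pair X X. r (unpair pair z)) t \<le> c"
  shows "lift_rel X r (t1, t2) \<le> c"
  unfolding lift_rel_eq[OF assms(1,2)] using assms(3) by (intro Sup_least) blast

text \<open>Besides the action on arrows, this yields monotonicity of the relation lifting by taking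
  \<open>f\<close> to be the identity.\<close>

lemma lift_rel_hom:
  assumes X: "X \<in> U" and Y: "Y \<in> U" and f: "f \<in> X \<rightarrow>\<^sub>E Y"
    and le: "\<And>x y. x \<in> X \<Longrightarrow> y \<in> X \<Longrightarrow> r (x, y) \<le> s (f x, f y)"
    and t: "t1 \<in> Fo F X" "t2 \<in> Fo F X"
  shows "lift_rel X r (t1, t2) \<le> lift_rel Y s (Fa F X Y f t1, Fa F X Y f t2)"
proof (rule lift_rel_le[OF t])
  let ?XX = "uprod pair X X"
  fix t
  assume t: "t \<in> Fo F ?XX" and t1: "Fa F ?XX X (proj1 pair X X) t = t1"
    and t2: "Fa F ?XX X (proj2 pair X X) t = t2"
  have XX: "?XX \<in> U"
    using X by (simp add: uprod_in_U)
  have "lift_pred ?XX (\<lambda>z\<in>?XX. r (unpair pair z)) t \<le>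
      lift_rel Y s (Fa F ?XX Y (compose ?XX f (proj1 pair X X)) t,
                    Fa F ?XX Y (compose ?XX f (proj2 pair X X)) t)"
  proof (rule lift_le_wasserstein[OF XX _ Y _ _ _ t])
    show "compose ?XX f (proj1 pair X X) \<in> ?XX \<rightarrow>\<^sub>E Y"
      "compose ?XX f (proj2 pair X X) \<in> ?XX \<rightarrow>\<^sub>E Y"
      using f proj1_in[of X X] proj2_in[of X X] by (auto simp: compose_def PiE_mem)
    fix z assume "z \<in> ?XX"
    then show "(\<lambda>z\<in>?XX. r (unpair pair z)) z
        \<le> s (compose ?XX f (proj1 pair X X) z, compose ?XX f (proj2 pair X X) z)"
      using le by (auto simp: compose_eq elim!: uprodE)
  qed simp
  then show "lift_pred ?XX (\<lambda>z\<in>?XX. r (unpair pair z)) t \<le>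
      lift_rel Y s (Fa F X Y f t1, Fa F X Y f t2)"
    by (simp add: F_compose_apply[OF XX X Y _ f t] proj1_in proj2_in t1 t2)
qed

text \<open>The hypothesis on \<open>r\<close> concerns diagonal values alone, so the lemma covers
  both \<open>diag_rel X\<close> itself and an arbitrary reflexive relation.\<close>

lemma lift_rel_refl:
  assumes X: "X \<in> U" and one: "le_on (Fo F X) (one_pred (Fo F X)) (lift_pred X (one_pred X))"
    and refl: "\<And>x. x \<in> X \<Longrightarrow> 1 \<le> r (x, x)"
  shows "le_on (Fo F X \<times> Fo F X) (diag_rel (Fo F X)) (lift_rel X r)"
proof -
  have "1 \<le> lift_rel X r (t, t)" if t: "t \<in> Fo F X" for t
  proof -
    have "1 \<le> lift_pred X (one_pred X) t"
      using one t by (simp add: le_on_def one_pred_def)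
    also have "\<dots> \<le> lift_rel X r (Fa F X X (\<lambda>x\<in>X. x) t, Fa F X X (\<lambda>x\<in>X. x) t)"
      using X refl t by (intro lift_le_wasserstein) (auto simp: one_pred_def)
    finally show ?thesis
      using X t by (simp add: F_id)
  qed
  \<comment> \<open>Off the diagonal the left-hand side is \<open>bot\<close>.\<close>
  then show ?thesis
    by (auto simp: le_on_def diag_rel_def)
qed

text \<open>One inequality suffices: exchanging \<open>t1\<close> and \<open>t2\<close> gives the
  other.\<close>

lemma lift_rel_swap_le:
  assumes X: "X \<in> U" and sym: "\<And>x y. x \<in> X \<Longrightarrow> y \<in> X \<Longrightarrow> r (x, y) = r (y, x)"
    and t: "t1 \<in> Fo F X" "t2 \<in> Fo F X"
  shows "lift_rel X r (t1, t2) \<le> lift_rel X r (t2, t1)"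
proof (rule lift_rel_le[OF t])
  let ?XX = "uprod pair X X"
  fix t
  assume t: "t \<in> Fo F ?XX" and t1: "Fa F ?XX X (proj1 pair X X) t = t1"
    and t2: "Fa F ?XX X (proj2 pair X X) t = t2"
  have "lift_pred ?XX (\<lambda>z\<in>?XX. r (unpair pair z)) t \<le>
      lift_rel X r (Fa F ?XX X (proj2 pair X X) t, Fa F ?XX X (proj1 pair X X) t)"
  proof (rule lift_le_wasserstein[OF _ _ X proj2_in proj1_in _ t])
    fix z assume "z \<in> ?XX"
    then show "(\<lambda>z\<in>?XX. r (unpair pair z)) z \<le> r (proj2 pair X X z, proj1 pair X X z)"
      using sym by (auto elim!: uprodE)
  qed (use X in \<open>auto simp: uprod_in_U\<close>)
  then show "lift_pred ?XX (\<lambda>z\<in>?XX. r (unpair pair z)) t \<le> lift_rel X r (t2, t1)"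
    by (simp add: t1 t2)
qed

section \<open>Gluing couplings and composition of relations\<close>

text \<open>This is the estimate for one coupling \<open>s\<close> and one coupling \<open>t\<close>
  with a common middle marginal, before suprema are taken.\<close>

lemma lift_pred_mult_le_lift_comp_rel:
  assumes fib: "fibred_lifting U F Fhat"
    and wpb: "preserves_weak_pullbacks (SetCat U) (SetCat U) F"
    and tens: preserves_tensor and X: "X \<in> U"
  defines "XX \<equiv> uprod pair X X"
  assumes s: "s \<in> Fo F XX" and t: "t \<in> Fo F XX"
    and st: "Fa F XX X (proj2 pair X X) s = Fa F XX X (proj1 pair X X) t"
  shows "lift_pred XX (\<lambda>z\<in>XX. p (unpair pair z)) s * lift_pred XX (\<lambda>z\<in>XX. q (unpair pair z)) t
    \<le> lift_rel X (comp_rel X p q)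
        (Fa F XX X (proj1 pair X X) s, Fa F XX X (proj2 pair X X) t)"
proof -
  \<comment> \<open>\<open>P\<close> consists of the composable pairs
    \<open>((x, z), (z, y))\<close>, with \<open>\<rho>1\<close> and \<open>\<rho>2\<close>
    returning the two halves.\<close>
  define P where "P = {w \<in> uprod pair XX XX.
    proj2 pair X X (proj1 pair XX XX w) = proj1 pair X X (proj2 pair XX XX w)}"
  define \<rho>1 where "\<rho>1 = restrict (proj1 pair XX XX) P"
  define \<rho>2 where "\<rho>2 = restrict (proj2 pair XX XX) P"
  let ?p = "\<lambda>z\<in>XX. p (unpair pair z)" and ?q = "\<lambda>z\<in>XX. q (unpair pair z)"
  let ?p' = "\<lambda>w\<in>P. ?p (\<rho>1 w)" and ?q' = "\<lambda>w\<in>P. ?q (\<rho>2 w)"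
  let ?\<pi>1 = "proj1 pair X X" and ?\<pi>2 = "proj2 pair X X"
  have XX: "XX \<in> U"
    using X by (simp add: XX_def uprod_in_U)
  have pi: "?\<pi>1 \<in> XX \<rightarrow>\<^sub>E X" "?\<pi>2 \<in> XX \<rightarrow>\<^sub>E X"
    by (simp_all add: XX_def proj1_in proj2_in)
  have wp: "weak_pullback (SetCat U) P XX XX X \<rho>1 \<rho>2 ?\<pi>2 ?\<pi>1"
    using weak_pullback_subset_uprod[OF XX XX X pi(2,1)] unfolding P_def \<rho>1_def \<rho>2_def .
  then have P: "P \<in> U" and rho: "\<rho>1 \<in> P \<rightarrow>\<^sub>E XX" "\<rho>2 \<in> P \<rightarrow>\<^sub>E XX"
    by (simp_all add: weak_pullback_def SetCat_def)
  have "weak_pullback (SetCat U) (Fo F P) (Fo F XX) (Fo F XX) (Fo F X)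
      (Fa F P XX \<rho>1) (Fa F P XX \<rho>2) (Fa F XX X ?\<pi>2) (Fa F XX X ?\<pi>1)"
    using wpb wp unfolding preserves_weak_pullbacks_def by blast
  \<comment> \<open>By \<open>st\<close> the couplings agree over the middle copy of
    \<open>X\<close>, so the weak pullback glues them to \<open>w\<close>.\<close>
  then obtain w where w: "w \<in> Fo F P" and ws: "Fa F P XX \<rho>1 w = s" and wt: "Fa F P XX \<rho>2 w = t"
    using s t st by (rule weak_pullback_element)
  \<comment> \<open>Fibredness moves both values to the same element \<open>w\<close>, where the
    tensor condition can combine them.\<close>
  have "lift_pred XX ?p s \<le> lift_pred P ?p' w" "lift_pred XX ?q t \<le> lift_pred P ?q' w"
    using fibred_lift_reindex[OF fib P XX _ rho(1) w, of ?p]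
      fibred_lift_reindex[OF fib P XX _ rho(2) w, of ?q] by (simp_all add: ws wt)
  then have "lift_pred XX ?p s * lift_pred XX ?q t \<le> lift_pred P ?p' w * lift_pred P ?q' w"
    by (rule quantale_mult_mono)
  also have "\<dots> \<le> lift_pred P (tensor_pred P ?p' ?q') w"
  proof -
    have "le_on (Fo F P) (tensor_pred (Fo F P) (lift_pred P ?p') (lift_pred P ?q'))
        (lift_pred P (tensor_pred P ?p' ?q'))"
      using tens P by simp
    then show ?thesis
      using w by (simp add: le_on_def tensor_pred_def)
  qed
  also have "\<dots> \<le> lift_rel X (comp_rel X p q)
      (Fa F P X (compose P ?\<pi>1 \<rho>1) w, Fa F P X (compose P ?\<pi>2 \<rho>2) w)"
  proof (rule lift_le_wasserstein[OF P _ X _ _ _ w])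
    show "tensor_pred P ?p' ?q' \<in> extensional P"
      by (simp add: tensor_pred_def)
    show "compose P ?\<pi>1 \<rho>1 \<in> P \<rightarrow>\<^sub>E X" "compose P ?\<pi>2 \<rho>2 \<in> P \<rightarrow>\<^sub>E X"
      using pi rho by (auto simp: compose_def PiE_mem)
    fix v assume v: "v \<in> P"
    then obtain a b where ab: "v = pair a b" "a \<in> XX" "b \<in> XX"
      and eq: "?\<pi>2 a = ?\<pi>1 b"
      unfolding P_def by (auto elim!: uprodE)
    obtain x z where a: "a = pair x z" "x \<in> X" "z \<in> X"
      using ab(2) unfolding XX_def by (rule uprodE)
    obtain z' y where b: "b = pair z' y" "z' \<in> X" "y \<in> X"
      using ab(3) unfolding XX_def by (rule uprodE)
    have z: "z' = z"
      using eq a b by simp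
    have r: "\<rho>1 v = a" "\<rho>2 v = b"
      using v ab by (simp_all add: \<rho>1_def \<rho>2_def)
    \<comment> \<open>On \<open>((x, z), (z, y))\<close> the tensor is the term with index
      \<open>z\<close> in the join defining \<open>comp_rel X p q (x, y)\<close>.\<close>
    have "tensor_pred P ?p' ?q' v = p (x, z) * q (z, y)"
      using v ab(2,3) by (simp add: tensor_pred_def r) (simp add: a b z)
    also have "\<dots> \<le> comp_rel X p q (x, y)"
      using a b by (auto simp: comp_rel_def intro!: SUP_upper)
    also have "(x, y) = (compose P ?\<pi>1 \<rho>1 v, compose P ?\<pi>2 \<rho>2 v)"
      using v a b by (simp add: compose_eq r)
    finally show "tensor_pred P ?p' ?q' v
        \<le> comp_rel X p q (compose P ?\<pi>1 \<rho>1 v, compose P ?\<pi>2 \<rho>2 v)" .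
  qed
  \<comment> \<open>The outer marginals of \<open>w\<close> are the first marginal of
    \<open>s\<close> and the second of \<open>t\<close>.\<close>
  also have "Fa F P X (compose P ?\<pi>1 \<rho>1) w = Fa F XX X ?\<pi>1 s"
    using F_compose_apply[OF P XX X rho(1) pi(1) w] by (simp add: ws)
  also have "Fa F P X (compose P ?\<pi>2 \<rho>2) w = Fa F XX X ?\<pi>2 t"
    using F_compose_apply[OF P XX X rho(2) pi(2) w] by (simp add: wt)
  finally show ?thesis .
qed

text \<open>For a fixed middle element \<open>z\<close>, both factors are suprema over couplings
  having \<open>z\<close> as a marginal; distributivity reduces the claim to one pair of
  couplings.\<close>

lemma lift_rel_comp:
  assumes fib: "fibred_lifting U F Fhat"
    and wpb: "preserves_weak_pullbacks (SetCat U) (SetCat U) F"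
    and tens: preserves_tensor and X: "X \<in> U"
  shows "le_on (Fo F X \<times> Fo F X) (comp_rel (Fo F X) (lift_rel X p) (lift_rel X q))
    (lift_rel X (comp_rel X p q))"
proof -
  have "lift_rel X p (x, z) * lift_rel X q (z, y) \<le> lift_rel X (comp_rel X p q) (x, y)"
    if x: "x \<in> Fo F X" and z: "z \<in> Fo F X" and y: "y \<in> Fo F X" for x y z
    unfolding lift_rel_eq[OF x z] lift_rel_eq[OF z y]
    by (rule quantale_Sup_mult_le)
      (use lift_pred_mult_le_lift_comp_rel[OF fib wpb tens X] in \<open>clarify, metis\<close>)
  then show ?thesis
    by (auto simp: le_on_def comp_rel_def intro!: SUP_least)
qed

section \<open>Preserved classes of relations and the induced liftings\<close>

lemma wasserstein_reflexive:
  assumes preserves_one "R \<in> Ob (VRel U)" "reflexive_rel R"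
  shows "reflexive_rel (Fo (wasserstein pair F Fhat) R)"
proof -
  obtain X r where R: "R = (X, r)"
    by (cases R)
  have X: "X \<in> U"
    using assms(2) by (simp add: R VRel_def)
  have "1 \<le> r (x, x)" if "x \<in> X" for x
    using assms(3) that by (force simp: R reflexive_rel_def le_on_def diag_rel_def)
  then show ?thesis
    using lift_rel_refl[OF X] assms(1) X by (simp add: reflexive_rel_def R case_prod_beta fst_wasserstein)
qed

lemma wasserstein_transitive:
  assumes "fibred_lifting U F Fhat" "preserves_weak_pullbacks (SetCat U) (SetCat U) F"
    preserves_tensor "R \<in> Ob (VRel U)" "transitive_rel R"
  shows "transitive_rel (Fo (wasserstein pair F Fhat) R)"
proof -
  obtain X r where R: "R = (X, r)"
    by (cases R)
  have X: "X \<in> U"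
    using assms(4) by (simp add: R VRel_def)
  have id: "(\<lambda>x\<in>X. x) \<in> X \<rightarrow>\<^sub>E X"
    by auto
  \<comment> \<open>Transitivity of \<open>r\<close> says that the identity is a morphism from
    \<open>comp_rel X r r\<close> to \<open>r\<close>.\<close>
  have "lift_rel X (comp_rel X r r) (x, y) \<le> lift_rel X r (x, y)"
    if "x \<in> Fo F X" "y \<in> Fo F X" for x y
    using lift_rel_hom[OF X X id _ that, of "comp_rel X r r" r] assms(5) that X
    by (simp add: F_id R transitive_rel_def le_on_def)
  then have "le_on (Fo F X \<times> Fo F X) (lift_rel X (comp_rel X r r)) (lift_rel X r)"
    by (auto simp: le_on_def)
  then have "le_on (Fo F X \<times> Fo F X) (comp_rel (Fo F X) (lift_rel X r) (lift_rel X r)) (lift_rel X r)"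
    using lift_rel_comp[OF assms(1-3) X, of r r] unfolding le_on_def by (meson order_trans)
  then show ?thesis
    by (simp add: transitive_rel_def R case_prod_beta fst_wasserstein)
qed

lemma wasserstein_symmetric:
  assumes "R \<in> Ob (VRel U)" "symmetric_rel R"
  shows "symmetric_rel (Fo (wasserstein pair F Fhat) R)"
proof -
  obtain X r where R: "R = (X, r)"
    by (cases R)
  have X: "X \<in> U"
    using assms(1) by (simp add: R VRel_def)
  have r: "r = (\<lambda>(x, y)\<in>X \<times> X. r (y, x))"
    using assms(2) unfolding R symmetric_rel_def prod.case .
  have "r (x, y) = r (y, x)" if "x \<in> X" "y \<in> X" for x y
    using fun_cong[OF r, of "(x, y)"] that by simp
  then have "lift_rel X r (x, y) = lift_rel X r (y, x)" if "x \<in> Fo F X" "y \<in> Fo F X" for x y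
    using lift_rel_swap_le[OF X] that by (intro order_antisym) auto
  \<comment> \<open>\<open>symmetric_rel\<close> is an equation between functions, so pointwise
    symmetry is combined with extensionality of both sides.\<close>
  then have "lift_rel X r = (\<lambda>(x, y)\<in>Fo F X \<times> Fo F X. lift_rel X r (y, x))"
    by (intro extensionalityI[OF lift_rel_extensional]) auto
  then have "symmetric_rel (Fo F X, lift_rel X r)"
    unfolding symmetric_rel_def prod.case .
  then show ?thesis
    unfolding R by (metis fst_wasserstein prod.collapse)
qed

text \<open>A general predicate \<open>Q\<close> treats \<open>VCat\<close> and
  \<open>VCat_sym\<close> together. On arrows the lifting acts as \<open>F\<close>, so identities
  and composites are inherited; closure of objects comes from \<open>Q\<close>, and the morphism
  condition from \<open>lift_rel_hom\<close>.\<close>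

lemma wasserstein_lifting_full_subcategory:
  assumes Q: "\<And>R. R \<in> Ob (VRel U) \<Longrightarrow> Q R \<Longrightarrow> Q (Fo (wasserstein pair F Fhat) R)"
  shows "is_lifting (full_subcategory (VRel U) Q) forgetful F (wasserstein pair F Fhat)"
proof -
  let ?W = "wasserstein pair F Fhat"
  let ?C = "full_subcategory (VRel U) Q"
  have ob: "Fo ?W R \<in> Ob ?C" if "R \<in> Ob ?C" for R
  proof -
    obtain X r where R: "R = (X, r)"
      by (cases R)
    have "Fo ?W R \<in> Ob (VRel U)"
      using that F_obj lift_rel_extensional[of X r]
      by (simp add: R full_subcategory_def VRel_def case_prod_beta fst_wasserstein)
    then show ?thesis
      using that Q by (simp add: full_subcategory_def)
  qed
  have hom: "Fa ?W A B f \<in> Hom ?C (Fo ?W A) (Fo ?W B)"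
    if "A \<in> Ob ?C" "B \<in> Ob ?C" "f \<in> Hom ?C A B" for A B f
  proof -
    obtain X r Y s where AB: "A = (X, r)" "B = (Y, s)"
      by (cases A, cases B)
    have X: "X \<in> U" and Y: "Y \<in> U" and f: "f \<in> X \<rightarrow>\<^sub>E Y"
      and le: "\<And>x y. x \<in> X \<Longrightarrow> y \<in> X \<Longrightarrow> r (x, y) \<le> s (f x, f y)"
      using that by (auto simp: AB full_subcategory_def VRel_def le_on_def)
    show ?thesis
      using F_map[OF X Y f] lift_rel_hom[of X Y f r s, OF X Y f le]
      by (simp add: AB full_subcategory_def VRel_def case_prod_beta fst_wasserstein
          Fa_wasserstein le_on_def)
  qed
  have ident: "Fa ?W A A (Ident ?C A) = Ident ?C (Fo ?W A)" if "A \<in> Ob ?C" for A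
    using that F_id
    by (cases A) (auto simp: full_subcategory_def VRel_def case_prod_beta fst_wasserstein
        Fa_wasserstein)
  have comp: "Fa ?W A Z (Comp ?C A B Z g f)
      = Comp ?C (Fo ?W A) (Fo ?W B) (Fo ?W Z) (Fa ?W B Z g) (Fa ?W A B f)"
    if "A \<in> Ob ?C" "B \<in> Ob ?C" "Z \<in> Ob ?C" "f \<in> Hom ?C A B" "g \<in> Hom ?C B Z" for A B Z f g
    using that F_compose
    by (cases A; cases B; cases Z) (auto simp: full_subcategory_def VRel_def case_prod_beta
        fst_wasserstein Fa_wasserstein)
  have "is_functor ?C ?C ?W"
    unfolding is_functor_def using ob hom ident comp by blast
  then show ?thesis
    by (auto simp: is_lifting_def forgetful_def Fa_wasserstein fst_wasserstein)
qed

end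

theorem theorem21:
  fixes U :: "'u set set"
    and pair :: "'u \<Rightarrow> 'u \<Rightarrow> 'u"
    and F :: "('u set, 'u \<Rightarrow> 'u, 'u set, 'u \<Rightarrow> 'u) functor_data"
    and Fhat :: "(('u, 'v::unital_comm_quantale) vpred, 'u \<Rightarrow> 'u, ('u, 'v) vpred, 'u \<Rightarrow> 'u) functor_data"
    and Fbar :: "(('u, 'v) vrel, 'u \<Rightarrow> 'u, ('u, 'v) vrel, 'u \<Rightarrow> 'u) functor_data"
  assumes "set_universe U pair"
    and "is_functor (SetCat U) (SetCat U) F"
    and "is_lifting (VPred U) forgetful F Fhat"
    and "Fbar = wasserstein pair F Fhat"
  shows
    "(\<forall>X\<in>U. le_on (Fo F X) (one_pred (Fo F X)) (snd (Fo Fhat (X, one_pred X))) \<longrightarrow>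
        le_on (Fo F X \<times> Fo F X) (diag_rel (Fo F X)) (snd (Fo Fbar (X, diag_rel X)))) \<and>
     ((\<forall>X\<in>U. le_on (Fo F X) (one_pred (Fo F X)) (snd (Fo Fhat (X, one_pred X)))) \<longrightarrow>
        (\<forall>R\<in>Ob (VRel U). reflexive_rel R \<longrightarrow> reflexive_rel (Fo Fbar R))) \<and>
     (fibred_lifting U F Fhat \<and>
      preserves_weak_pullbacks (SetCat U) (SetCat U) F \<and>
      (\<forall>X\<in>U. \<forall>p\<in>extensional X. \<forall>q\<in>extensional X.
         le_on (Fo F X) (tensor_pred (Fo F X) (snd (Fo Fhat (X, p))) (snd (Fo Fhat (X, q))))
           (snd (Fo Fhat (X, tensor_pred X p q)))) \<longrightarrow>
        (\<forall>X\<in>U. \<forall>p\<in>extensional (X \<times> X). \<forall>q\<in>extensional (X \<times> X).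
           le_on (Fo F X \<times> Fo F X)
             (comp_rel (Fo F X) (snd (Fo Fbar (X, p))) (snd (Fo Fbar (X, q))))
             (snd (Fo Fbar (X, comp_rel X p q)))) \<and>
        (\<forall>R\<in>Ob (VRel U). transitive_rel R \<longrightarrow> transitive_rel (Fo Fbar R))) \<and>
     (\<forall>R\<in>Ob (VRel U). symmetric_rel R \<longrightarrow> symmetric_rel (Fo Fbar R)) \<and>
     ((\<forall>X\<in>U. le_on (Fo F X) (one_pred (Fo F X)) (snd (Fo Fhat (X, one_pred X)))) \<and>
      fibred_lifting U F Fhat \<and>
      preserves_weak_pullbacks (SetCat U) (SetCat U) F \<and>
      (\<forall>X\<in>U. \<forall>p\<in>extensional X. \<forall>q\<in>extensional X.
         le_on (Fo F X) (tensor_pred (Fo F X) (snd (Fo Fhat (X, p))) (snd (Fo Fhat (X, q))))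
           (snd (Fo Fhat (X, tensor_pred X p q)))) \<longrightarrow>
        is_lifting (VCat U) forgetful F Fbar \<and> is_lifting (VCat_sym U) forgetful F Fbar)"
proof -
  interpret set_functor_lifting U pair F Fhat
    using assms by (simp add: set_functor_lifting_def set_functor_lifting_axioms_def)
  have diag: "le_on (Fo F X \<times> Fo F X) (diag_rel (Fo F X)) (lift_rel X (diag_rel X))"
    if "X \<in> U" "le_on (Fo F X) (one_pred (Fo F X)) (lift_pred X (one_pred X))" for X
    using that by (rule lift_rel_refl) (simp add: diag_rel_def)
  have cat: "is_lifting (VCat U) forgetful F (wasserstein pair F Fhat) \<and>
      is_lifting (VCat_sym U) forgetful F (wasserstein pair F Fhat)"
    if "preserves_one" "fibred_lifting U F Fhat"
      "preserves_weak_pullbacks (SetCat U) (SetCat U) F" "preserves_tensor"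
    unfolding VCat_def VCat_sym_def
    using wasserstein_reflexive[OF that(1)] wasserstein_transitive[OF that(2-4)]
      wasserstein_symmetric
    by (intro conjI wasserstein_lifting_full_subcategory) blast+
  show ?thesis
    unfolding assms(4)
    by (intro conjI impI ballI; (elim conjE)?)
      (simp_all only: diag wasserstein_reflexive lift_rel_comp wasserstein_transitive
        wasserstein_symmetric cat)
qed

end
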